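(* Let $G$ be a group, let $n\ge 1$, and let $R_1,\ldots,R_n$ be normal subgroups of $G$. Then $$[[R_1,R_2],\ldots,R_n]_S=\prod_{\sigma\in\Sigma_{n-1}}[[R_1,R_{\sigma(2)}],\ldots,R_{\sigma(n)}],$$ where $\Sigma_{n-1}$ acts as the symmetric group on $\{2,3,\ldots,n\}$.
   Context: Commutators: $[a,b]=a^{-1}b^{-1}ab$. For subgroups $S_1,\ldots,S_n$ of $G$, $[[S_1,S_2],\ldots,S_n]$ denotes the subgroup generated by the left iterated commutators $[[[g_1,g_2],g_3],\ldots,g_n]$ with $g_i\in S_i$ (for $n=1$ it is $S_1$). Symmetric commutator subgroup: $$[[R_1,R_2],\ldots,R_n]_S=\prod_{\sigma\in\Sigma_n}[[R_{\sigma(1)},R_{\sigma(2)}],\ldots,R_{\sigma(n)}],$$ where $\Sigma_n$ is the symmetric group on $\{1,\ldots,n\}$; $[R_1]_S=R_1$ for $n=1$. (For normal $R_i$ each factor is normal in $G$, so the products are normal subgroups independent of the order of the factors.) *)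

theory Defs
  imports "HOL-Algebra.Algebra" "HOL-Combinatorics.Permutations"
begin

text \<open>The convention is $[a,b] = a^{-1}b^{-1}ab$; it differs from the one built into the
  library's \<open>derived_set\<close>.\<close>

definition commutator :: "('a, 'b) monoid_scheme \<Rightarrow> 'a \<Rightarrow> 'a \<Rightarrow> 'a"
  where "commutator G a b = inv\<^bsub>G\<^esub> a \<otimes>\<^bsub>G\<^esub> inv\<^bsub>G\<^esub> b \<otimes>\<^bsub>G\<^esub> a \<otimes>\<^bsub>G\<^esub> b"

text \<open>Families are indexed by \<open>1, \<dots>, n\<close>, with \<open>n \<ge> 1\<close>:
  \<open>iter_commutator G g n\<close> is $[[[g_1,g_2],g_3],\ldots,g_n]$, and $g_1$ if $n = 1$.\<close>

definition iter_commutator :: "('a, 'b) monoid_scheme \<Rightarrow> (nat \<Rightarrow> 'a) \<Rightarrow> nat \<Rightarrow> 'a"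
  where "iter_commutator G g n = foldl (commutator G) (g 1) (map g [2..<Suc n])"

definition iter_commutator_subgroup ::
    "('a, 'b) monoid_scheme \<Rightarrow> (nat \<Rightarrow> 'a set) \<Rightarrow> nat \<Rightarrow> 'a set"
  where "iter_commutator_subgroup G S n =
    generate G {iter_commutator G g n | g. \<forall>i\<in>{1..n}. g i \<in> S i}"

text \<open>The normal subgroups of \<open>G\<close> form a commutative monoid under the elementwise product
  \<open>H <#> K\<close>. A finite product of normal subgroups is a \<open>finprod\<close> in this monoid; the lemmas
  below show that all factors involved do lie in its carrier.\<close>

definition normal_monoid :: "('a, 'b) monoid_scheme \<Rightarrow> 'a set monoid"
  where "normal_monoid G =
    \<lparr>carrier = {N. N \<lhd> G}, monoid.mult = set_mult G, one = {\<one>\<^bsub>G\<^esub>}\<rparr>"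

definition symmetric_commutator_subgroup ::
    "('a, 'b) monoid_scheme \<Rightarrow> (nat \<Rightarrow> 'a set) \<Rightarrow> nat \<Rightarrow> 'a set"
  where "symmetric_commutator_subgroup G R n =
    finprod (normal_monoid G) (\<lambda>\<sigma>. iter_commutator_subgroup G (R \<circ> \<sigma>) n)
      {\<sigma>. \<sigma> permutes {1..n}}"

lemma (in group) normal_monoid_comm_monoid: "comm_monoid (normal_monoid G)"
proof (rule comm_monoidI)
  fix H K L
  assume "H \<in> carrier (normal_monoid G)" "K \<in> carrier (normal_monoid G)"
  then have HK: "H \<lhd> G" "K \<lhd> G"
    by (auto simp: normal_monoid_def)
  then have subs: "subgroup H G" "subgroup K G"
    using normal_imp_subgroup by auto
  show "H \<otimes>\<^bsub>normal_monoid G\<^esub> K \<in> carrier (normal_monoid G)"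
    using HK by (simp add: normal_monoid_def normal_subgroup_set_mult_closed)
  show "H \<otimes>\<^bsub>normal_monoid G\<^esub> K = K \<otimes>\<^bsub>normal_monoid G\<^esub> H"
    using HK subs by (simp add: normal_monoid_def commut_normal)
  assume "L \<in> carrier (normal_monoid G)"
  then have "subgroup L G"
    by (auto simp: normal_monoid_def normal_imp_subgroup)
  then show "H \<otimes>\<^bsub>normal_monoid G\<^esub> K \<otimes>\<^bsub>normal_monoid G\<^esub> L =
      H \<otimes>\<^bsub>normal_monoid G\<^esub> (K \<otimes>\<^bsub>normal_monoid G\<^esub> L)"
    using subs by (simp add: normal_monoid_def set_mult_assoc subgroup.subset)
next
  show "\<one>\<^bsub>normal_monoid G\<^esub> \<in> carrier (normal_monoid G)"
    by (simp add: normal_monoid_def one_is_normal)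
next
  fix H assume "H \<in> carrier (normal_monoid G)"
  then have "H \<subseteq> carrier G"
    by (auto simp: normal_monoid_def dest: normal_imp_subgroup subgroup.mem_carrier)
  then show "\<one>\<^bsub>normal_monoid G\<^esub> \<otimes>\<^bsub>normal_monoid G\<^esub> H = H"
    by (auto simp: normal_monoid_def set_mult_def subset_iff)
qed

lemma iter_commutator_1: "iter_commutator G g 1 = g 1"
  by (simp add: iter_commutator_def)

lemma iter_commutator_Suc:
  "n \<ge> 1 \<Longrightarrow>
    iter_commutator G g (Suc n) = commutator G (iter_commutator G g n) (g (Suc n))"
  by (simp add: iter_commutator_def)

lemma (in group) iter_commutator_subgroup_1:
  assumes "subgroup (S 1) G"
  shows "iter_commutator_subgroup G S 1 = S 1"
proof -
  have "{iter_commutator G g 1 | g. \<forall>i\<in>{1..1}. g i \<in> S i} = S 1"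
  proof (intro equalityI subsetI)
    fix x assume "x \<in> S 1"
    then show "x \<in> {iter_commutator G g 1 | g. \<forall>i\<in>{1..1}. g i \<in> S i}"
      by (intro CollectI exI[of _ "\<lambda>_. x"]) (simp add: iter_commutator_def)
  qed (auto simp: iter_commutator_def)
  then have "iter_commutator_subgroup G S 1 = generate G (S 1)"
    unfolding iter_commutator_subgroup_def by (rule arg_cong)
  moreover have "S 1 = generate G (S 1)"
    using assms by (intro generateI) auto
  ultimately show ?thesis
    by simp
qed

lemma (in group) commutator_closed [simp]:
  "a \<in> carrier G \<Longrightarrow> b \<in> carrier G \<Longrightarrow> commutator G a b \<in> carrier G"
  by (simp add: commutator_def)

lemma (in group) commutator_conj:
  assumes "x \<in> carrier G" "a \<in> carrier G" "b \<in> carrier G"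
  shows "x \<otimes> commutator G a b \<otimes> inv x =
    commutator G (x \<otimes> a \<otimes> inv x) (x \<otimes> b \<otimes> inv x)"
proof -
  have "inv x \<otimes> (x \<otimes> y) = y" if "y \<in> carrier G" for y
    using that assms(1) by (simp flip: m_assoc)
  then show ?thesis
    using assms by (simp add: commutator_def m_assoc inv_mult_group)
qed

lemma (in group) iter_commutator_conj:
  assumes "n \<ge> 1" "x \<in> carrier G" "\<And>i. i \<in> {1..n} \<Longrightarrow> g i \<in> carrier G"
  shows "iter_commutator G g n \<in> carrier G"
    and "x \<otimes> iter_commutator G g n \<otimes> inv x =
      iter_commutator G (\<lambda>i. x \<otimes> g i \<otimes> inv x) n"
proof -
  have "iter_commutator G g n \<in> carrier G \<and>
      x \<otimes> iter_commutator G g n \<otimes> inv x =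
      iter_commutator G (\<lambda>i. x \<otimes> g i \<otimes> inv x) n"
    using assms(1,3)
  proof (induction n rule: dec_induct)
    case base
    then show ?case by (simp add: iter_commutator_def)
  next
    case (step n)
    then show ?case
      using assms(2) by (simp add: iter_commutator_Suc commutator_conj)
  qed
  then show "iter_commutator G g n \<in> carrier G"
    and "x \<otimes> iter_commutator G g n \<otimes> inv x =
      iter_commutator G (\<lambda>i. x \<otimes> g i \<otimes> inv x) n"
    by auto
qed

lemma (in group) iter_commutator_subgroup_normal:
  assumes n: "n \<ge> 1" and S: "\<And>i. i \<in> {1..n} \<Longrightarrow> S i \<lhd> G"
  shows "iter_commutator_subgroup G S n \<lhd> G"
  unfolding iter_commutator_subgroup_def
proof (rule normal_generateI)
  have c: "g i \<in> carrier G" if "\<forall>i\<in>{1..n}. g i \<in> S i" "i \<in> {1..n}" for g i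
    using subgroup.mem_carrier[OF normal_imp_subgroup[OF S[OF that(2)]]] that by blast
  show "{iter_commutator G g n | g. \<forall>i\<in>{1..n}. g i \<in> S i} \<subseteq> carrier G"
    using iter_commutator_conj(1)[OF n one_closed] c by blast
  fix h x
  assume "h \<in> {iter_commutator G g n | g. \<forall>i\<in>{1..n}. g i \<in> S i}" and x: "x \<in> carrier G"
  then obtain g where g: "h = iter_commutator G g n" "\<forall>i\<in>{1..n}. g i \<in> S i"
    by blast
  have "x \<otimes> h \<otimes> inv x = iter_commutator G (\<lambda>i. x \<otimes> g i \<otimes> inv x) n"
    using iter_commutator_conj(2)[OF n x] c g by blast
  moreover have "\<forall>i\<in>{1..n}. x \<otimes> g i \<otimes> inv x \<in> S i"
    using normal_invE(2)[OF S] x g(2) by blast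
  ultimately show "x \<otimes> h \<otimes> inv x \<in>
      {iter_commutator G g n | g. \<forall>i\<in>{1..n}. g i \<in> S i}"
    by blast
qed

lemma (in group) iter_commutator_subgroup_permuted_in_carrier:
  assumes "n \<ge> 1" "\<And>i. i \<in> {1..n} \<Longrightarrow> R i \<lhd> G" "\<sigma> permutes {1..n}"
  shows "iter_commutator_subgroup G (R \<circ> \<sigma>) n \<in> carrier (normal_monoid G)"
proof -
  have "(R \<circ> \<sigma>) i \<lhd> G" if "i \<in> {1..n}" for i
    unfolding comp_def using assms(2) that permutes_in_image[OF assms(3)] by blast
  then show ?thesis
    using iter_commutator_subgroup_normal[OF assms(1)] by (simp add: normal_monoid_def)
qed

end

theory Submission
  imports Defs
begin

text \<open>
  Write \<open>[H, K]\<close> for the subgroup generated by the commutators of two normal subgroups. A product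
  of normal subgroups is their join among the normal subgroups, so the theorem says that a normal
  subgroup \<open>N\<close> containing every \<open>[[R\<^sub>1, R\<^sub>\<tau>\<^sub>(\<^sub>2\<^sub>)], \<dots>, R\<^sub>\<tau>\<^sub>(\<^sub>n\<^sub>)]\<close>, with \<open>R\<^sub>1\<close> in first place, also
  contains those commutator subgroups in which \<open>R\<^sub>1\<close> stands at another place. As the \<open>R\<^sub>i\<close> are
  normal, the subgroup generated by the iterated commutators of elements is the iterated commutator
  of subgroups (\<open>iter_commutator_subgroup_eq_foldl\<close>). If \<open>R\<^sub>1\<close> is not in first place, this subgroup
  is \<open>[[[C, R\<^sub>1], B\<^sub>1], \<dots>, B\<^sub>m]\<close>, with \<open>C\<close> the iterated commutator of the entries before \<open>R\<^sub>1\<close>.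

  The entries after \<open>R\<^sub>1\<close> are removed by an adjunction: \<open>[H, K] \<subseteq> N\<close> means that \<open>H\<close> lies in the
  centralizer of \<open>K\<close> modulo \<open>N\<close>, which is again a normal subgroup. What is left is an inclusion
  of \<open>[C, R\<^sub>1] = [R\<^sub>1, C]\<close> in a normal subgroup (\<open>foldl_commutator_subgroup_swap\<close>). By the three
  subgroups lemma, \<open>[R\<^sub>1, [C', K]]\<close> lies in the product of \<open>[[R\<^sub>1, C'], K]\<close> and \<open>[[R\<^sub>1, K], C']\<close>; in
  both terms the bracket \<open>C'\<close> is shorter than \<open>C = [C', K]\<close>, and induction on the length unfolds
  it until only left-normed commutators that start with \<open>R\<^sub>1\<close> are left.
\<close>


section \<open>Commutators of normal subgroups\<close>

definition commutator_subgroup :: "('a, 'b) monoid_scheme \<Rightarrow> 'a set \<Rightarrow> 'a set \<Rightarrow> 'a set"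
  where "commutator_subgroup G H K = generate G (\<Union>h\<in>H. \<Union>k\<in>K. {commutator G h k})"

definition centralizer_mod :: "('a, 'b) monoid_scheme \<Rightarrow> 'a set \<Rightarrow> 'a set \<Rightarrow> 'a set"
  where "centralizer_mod G N K = {g \<in> carrier G. \<forall>k\<in>K. commutator G g k \<in> N}"

context group
begin

lemma normal_subset_carrier: "N \<lhd> G \<Longrightarrow> N \<subseteq> carrier G"
  by (simp add: normal_imp_subgroup subgroup.subset)

lemma inv_mult_cancel_left:
  "x \<in> carrier G \<Longrightarrow> y \<in> carrier G \<Longrightarrow> inv x \<otimes> (x \<otimes> y) = y"
  "x \<in> carrier G \<Longrightarrow> y \<in> carrier G \<Longrightarrow> x \<otimes> (inv x \<otimes> y) = y"
  by (simp_all flip: m_assoc)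

text \<open>Together with the default rules for groups, these reduce a word to its free normal form, so
  that they decide the identities valid in all groups.\<close>

lemmas word_simps = commutator_def m_assoc inv_mult_group inv_mult_cancel_left

lemma inv_commutator:
  "a \<in> carrier G \<Longrightarrow> b \<in> carrier G \<Longrightarrow> inv (commutator G a b) = commutator G b a"
  by (simp add: word_simps)

lemma commutator_mult_left:
  assumes "a \<in> carrier G" "b \<in> carrier G" "c \<in> carrier G"
  shows "commutator G (a \<otimes> b) c = inv b \<otimes> commutator G a c \<otimes> b \<otimes> commutator G b c"
  using assms by (simp add: word_simps)

lemma commutator_inv_left:
  assumes "a \<in> carrier G" "c \<in> carrier G"
  shows "commutator G (inv a) c = a \<otimes> inv (commutator G a c) \<otimes> inv a"
  using assms by (simp add: word_simps)

lemma middle_factor_in_subgroup: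
  assumes "subgroup N G" "u \<in> N" "w \<in> N" "v \<in> carrier G" "u \<otimes> v \<otimes> w = \<one>"
  shows "v \<in> N"
proof -
  have uw: "u \<in> carrier G" "w \<in> carrier G"
    using assms(1-3) by (simp_all add: subgroup.mem_carrier)
  have "v = inv u \<otimes> (u \<otimes> v \<otimes> w) \<otimes> inv w"
    using assms(4) uw by (simp add: m_assoc inv_mult_cancel_left)
  also have "\<dots> = inv u \<otimes> inv w"
    using assms(5) uw by simp
  also have "\<dots> \<in> N"
    using assms(1-3) by (simp add: subgroup.m_closed subgroup.m_inv_closed)
  finally show ?thesis .
qed

lemma hall_witt:
  assumes "a \<in> carrier G" "b \<in> carrier G" "c \<in> carrier G"
  shows "(inv b \<otimes> commutator G (commutator G a (inv b)) c \<otimes> b) \<otimes>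
    (inv c \<otimes> commutator G (commutator G b (inv c)) a \<otimes> c) \<otimes>
    (inv a \<otimes> commutator G (commutator G c (inv a)) b \<otimes> a) = \<one>"
  using assms by (simp add: word_simps)

lemma commutator_subgroup_commute:
  assumes "H \<subseteq> carrier G" "K \<subseteq> carrier G"
  shows "commutator_subgroup G H K = commutator_subgroup G K H"
proof -
  have "commutator_subgroup G H K \<subseteq> commutator_subgroup G K H"
    if "H \<subseteq> carrier G" "K \<subseteq> carrier G" for H K
    unfolding commutator_subgroup_def
  proof (rule generate_subgroup_incl)
    let ?X = "\<Union>k\<in>K. \<Union>h\<in>H. {commutator G k h}"
    have "?X \<subseteq> carrier G"
      using that commutator_closed by blast
    then show "subgroup (generate G ?X) G"
      by (rule generate_is_subgroup)
    show "(\<Union>h\<in>H. \<Union>k\<in>K. {commutator G h k}) \<subseteq> generate G ?X"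
    proof clarify
      fix h k assume hk: "h \<in> H" "k \<in> K"
      then have "inv (commutator G k h) \<in> generate G ?X"
        by (intro generate.inv) blast
      then show "commutator G h k \<in> generate G ?X"
        using hk that by (simp add: inv_commutator subset_iff)
    qed
  qed
  then show ?thesis
    using assms by blast
qed

lemma commutator_in_commutator_subgroup:
  "h \<in> H \<Longrightarrow> k \<in> K \<Longrightarrow> commutator G h k \<in> commutator_subgroup G H K"
  unfolding commutator_subgroup_def by (intro generate.incl) blast

lemma commutator_subgroup_normal:
  assumes "H \<lhd> G" "K \<lhd> G"
  shows "commutator_subgroup G H K \<lhd> G"
  unfolding commutator_subgroup_def
proof (rule normal_generateI)
  note sub = normal_subset_carrier[OF assms(1)] normal_subset_carrier[OF assms(2)]
  show "(\<Union>h\<in>H. \<Union>k\<in>K. {commutator G h k}) \<subseteq> carrier G"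
    using sub commutator_closed by blast
  fix y x
  assume "y \<in> (\<Union>h\<in>H. \<Union>k\<in>K. {commutator G h k})" and x: "x \<in> carrier G"
  then obtain h k where y: "h \<in> H" "k \<in> K" "y = commutator G h k"
    by blast
  then have "x \<otimes> y \<otimes> inv x = commutator G (x \<otimes> h \<otimes> inv x) (x \<otimes> k \<otimes> inv x)"
    using x sub by (auto intro!: commutator_conj)
  then show "x \<otimes> y \<otimes> inv x \<in> (\<Union>h\<in>H. \<Union>k\<in>K. {commutator G h k})"
    using normal_invE(2)[OF assms(1) x y(1)] normal_invE(2)[OF assms(2) x y(2)] by blast
qed

lemma centralizer_mod_normal:
  assumes N: "N \<lhd> G" and K: "K \<lhd> G"
  shows "centralizer_mod G N K \<lhd> G"
proof (rule normal_invI)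
  note sub = normal_subset_carrier[OF K]
  note N_closed = subgroup.m_closed[OF normal_imp_subgroup[OF N]]
    subgroup.m_inv_closed[OF normal_imp_subgroup[OF N]]
  note N_conj = normal_invE(2)[OF N]
  show "subgroup (centralizer_mod G N K) G"
  proof (rule subgroupI)
    have "commutator G \<one> k \<in> N" if "k \<in> K" for k
      using that sub subgroup.one_closed[OF normal_imp_subgroup[OF N]]
      by (auto simp: commutator_def)
    then show "centralizer_mod G N K \<noteq> {}"
      by (auto simp: centralizer_mod_def)
  next
    fix a assume "a \<in> centralizer_mod G N K"
    then show "inv a \<in> centralizer_mod G N K"
      using sub N_closed N_conj
      by (auto simp: centralizer_mod_def commutator_inv_left subset_iff)
  next
    fix a b assume "a \<in> centralizer_mod G N K" "b \<in> centralizer_mod G N K"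
    then show "a \<otimes> b \<in> centralizer_mod G N K"
      using sub N_closed N_conj[of "inv b"]
      by (auto simp: centralizer_mod_def commutator_mult_left subset_iff)
  qed (auto simp: centralizer_mod_def)
next
  fix x g assume x: "x \<in> carrier G" and g: "g \<in> centralizer_mod G N K"
  have "commutator G (x \<otimes> g \<otimes> inv x) k \<in> N" if k: "k \<in> K" for k
  proof -
    \<comment> \<open>Conjugation moves from \<open>g\<close> to \<open>k\<close>, and \<open>K\<close> is normal.\<close>
    have kc: "k \<in> carrier G" "g \<in> carrier G"
      using k g normal_subset_carrier[OF K] by (auto simp: centralizer_mod_def)
    have "inv x \<otimes> k \<otimes> inv (inv x) \<in> K"
      using normal_invE(2)[OF K, of "inv x" k] x k by blast
    then have "x \<otimes> commutator G g (inv x \<otimes> k \<otimes> inv (inv x)) \<otimes> inv x \<in> N"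
      using normal_invE(2)[OF N x] g by (auto simp: centralizer_mod_def)
    then show ?thesis
      using x kc by (simp add: word_simps)
  qed
  then show "x \<otimes> g \<otimes> inv x \<in> centralizer_mod G N K"
    using x g by (auto simp: centralizer_mod_def)
qed

text \<open>The adjunction that turns an inclusion of a commutator subgroup into one of its first
  argument. It plays the part of additivity in the first argument: if \<open>K\<close> is normal, the centralizer
  is a subgroup, so \<open>[H, K]\<close> is bounded by looking at generators of \<open>H\<close> only.\<close>

lemma commutator_subgroup_subset_iff:
  assumes "H \<subseteq> carrier G" "N \<lhd> G"
  shows "commutator_subgroup G H K \<subseteq> N \<longleftrightarrow> H \<subseteq> centralizer_mod G N K"
proof
  assume "commutator_subgroup G H K \<subseteq> N"
  then show "H \<subseteq> centralizer_mod G N K"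
    using assms(1) commutator_in_commutator_subgroup by (fastforce simp: centralizer_mod_def)
next
  assume "H \<subseteq> centralizer_mod G N K"
  then show "commutator_subgroup G H K \<subseteq> N"
    unfolding commutator_subgroup_def
    by (intro generate_subgroup_incl normal_imp_subgroup[OF assms(2)])
      (auto simp: centralizer_mod_def)
qed

text \<open>In the Hall--Witt identity two of the three factors lie in \<open>N\<close>, hence so does the third.\<close>

lemma three_subgroups:
  assumes normal: "H \<lhd> G" "K \<lhd> G" "L \<lhd> G" "N \<lhd> G"
    and HKL: "commutator_subgroup G (commutator_subgroup G H K) L \<subseteq> N"
    and HLK: "commutator_subgroup G (commutator_subgroup G H L) K \<subseteq> N"
  shows "commutator_subgroup G (commutator_subgroup G K L) H \<subseteq> N"
proof -
  note sub = normal[THEN normal_subset_carrier]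
  note subgrp = normal[THEN normal_imp_subgroup]
  note N_conj = normal_invE(2)[OF normal(4)]
  have key: "commutator G (commutator G b c) a \<in> N" if "a \<in> H" "b \<in> K" "c \<in> L" for a b c
  proof -
    \<comment> \<open>The middle factor of the identity has an inverted second entry, which must become \<open>c\<close>.\<close>
    define d where "d = inv c"
    have abc: "a \<in> carrier G" "b \<in> carrier G" "c \<in> carrier G"
      using that sub by auto
    have c: "c = inv d" and d: "d \<in> L" "d \<in> carrier G"
      using subgroup.m_inv_closed[OF subgrp(3) that(3)] abc by (simp_all add: d_def)
    have inv: "inv a \<in> H" "inv b \<in> K"
      using subgroup.m_inv_closed[OF subgrp(1) that(1)] subgroup.m_inv_closed[OF subgrp(2) that(2)]
      by auto
    let ?u = "inv b \<otimes> commutator G (commutator G a (inv b)) d \<otimes> b"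
    let ?v = "inv d \<otimes> commutator G (commutator G b (inv d)) a \<otimes> d"
    let ?w = "inv a \<otimes> commutator G (commutator G d (inv a)) b \<otimes> a"
    have "commutator G (commutator G a (inv b)) d \<in> N"
      using that(1) inv(2) d(1) by (intro subsetD[OF HKL] commutator_in_commutator_subgroup)
    then have u: "?u \<in> N"
      using N_conj[of "inv b" "commutator G (commutator G a (inv b)) d"] abc by simp
    have "commutator G d (inv a) \<in> commutator_subgroup G H L"
      using commutator_in_commutator_subgroup[OF d(1) inv(1)]
        commutator_subgroup_commute[OF sub(1) sub(3)] by simp
    then have "commutator G (commutator G d (inv a)) b \<in> N"
      using that(2) by (rule subsetD[OF HLK commutator_in_commutator_subgroup])
    then have w: "?w \<in> N"
      using N_conj[of "inv a" "commutator G (commutator G d (inv a)) b"] abc by simp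
    have "?u \<otimes> ?v \<otimes> ?w = \<one>"
      using abc(1,2) d(2) by (rule hall_witt)
    then have v: "?v \<in> N"
      using middle_factor_in_subgroup[OF subgrp(4) u w] abc d(2) by simp
    have "d \<otimes> ?v \<otimes> inv d = commutator G (commutator G b c) a"
      using abc d(2) c by (simp add: m_assoc inv_mult_cancel_left)
    then show ?thesis
      using N_conj[OF d(2) v] by simp
  qed
  have "commutator_subgroup G K L \<subseteq> centralizer_mod G N H"
    unfolding commutator_subgroup_def
    using sub key
    by (intro generate_subgroup_incl normal_imp_subgroup[OF centralizer_mod_normal] normal)
      (auto simp: centralizer_mod_def subset_iff)
  then show ?thesis
    using commutator_subgroup_subset_iff normal(4)
      normal_subset_carrier[OF commutator_subgroup_normal[OF normal(2,3)]] by blast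
qed


section \<open>Iterated commutators of normal subgroups\<close>

lemma foldl_commutator_subgroup_normal:
  assumes "H \<lhd> G" "\<And>K. K \<in> set Ks \<Longrightarrow> K \<lhd> G"
  shows "foldl (commutator_subgroup G) H Ks \<lhd> G"
  using assms by (induction Ks arbitrary: H) (auto simp: commutator_subgroup_normal)

lemma foldr_centralizer_mod_normal:
  assumes "N \<lhd> G" "\<And>K. K \<in> set Ks \<Longrightarrow> K \<lhd> G"
  shows "foldr (\<lambda>K N. centralizer_mod G N K) Ks N \<lhd> G"
  using assms by (induction Ks) (auto simp: centralizer_mod_normal)

lemma foldl_commutator_subgroup_subset_iff:
  assumes "H \<lhd> G" "N \<lhd> G" "\<And>K. K \<in> set Ks \<Longrightarrow> K \<lhd> G"
  shows "foldl (commutator_subgroup G) H Ks \<subseteq> N \<longleftrightarrow>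
    H \<subseteq> foldr (\<lambda>K N. centralizer_mod G N K) Ks N"
  using assms
  by (induction Ks arbitrary: H)
    (auto simp: commutator_subgroup_normal commutator_subgroup_subset_iff
      foldr_centralizer_mod_normal normal_subset_carrier)

text \<open>The generators of the left-hand side only involve pure iterated commutators, whereas on the
  right each bracket runs over all of the subgroup before it. Normality closes the gap: the
  elements whose commutators with \<open>S (Suc n)\<close> lie in the left-hand side form a subgroup.\<close>

lemma iter_commutator_subgroup_Suc:
  assumes n: "n \<ge> 1" and S: "\<And>i. i \<in> {1..Suc n} \<Longrightarrow> S i \<lhd> G"
  shows "iter_commutator_subgroup G S (Suc n) =
    commutator_subgroup G (iter_commutator_subgroup G S n) (S (Suc n))"
proof
  let ?M = "iter_commutator_subgroup G S (Suc n)"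
  let ?C = "iter_commutator_subgroup G S n"
  have M: "?M \<lhd> G"
    using S by (intro iter_commutator_subgroup_normal) auto
  have C: "?C \<lhd> G"
    using n S by (intro iter_commutator_subgroup_normal) auto
  have Sn: "S (Suc n) \<lhd> G"
    using S by simp
  show "?M \<subseteq> commutator_subgroup G ?C (S (Suc n))"
    unfolding iter_commutator_subgroup_def[of G S "Suc n"]
  proof (rule generate_subgroup_incl)
    show "subgroup (commutator_subgroup G ?C (S (Suc n))) G"
      using C Sn by (intro normal_imp_subgroup commutator_subgroup_normal)
    show "{iter_commutator G g (Suc n) | g. \<forall>i\<in>{1..Suc n}. g i \<in> S i}
        \<subseteq> commutator_subgroup G ?C (S (Suc n))"
    proof clarify
      fix g assume g: "\<forall>i\<in>{1..Suc n}. g i \<in> S i"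
      then have "iter_commutator G g n \<in> ?C"
        unfolding iter_commutator_subgroup_def by (intro generate.incl) auto
      then show "iter_commutator G g (Suc n) \<in> commutator_subgroup G ?C (S (Suc n))"
        using g n by (simp add: iter_commutator_Suc commutator_in_commutator_subgroup)
    qed
  qed
  have "?C \<subseteq> centralizer_mod G ?M (S (Suc n))"
    unfolding iter_commutator_subgroup_def[of G S n]
  proof (rule generate_subgroup_incl)
    show "subgroup (centralizer_mod G ?M (S (Suc n))) G"
      using M Sn by (intro normal_imp_subgroup centralizer_mod_normal)
    show "{iter_commutator G g n | g. \<forall>i\<in>{1..n}. g i \<in> S i}
        \<subseteq> centralizer_mod G ?M (S (Suc n))"
    proof clarify
      fix g assume g: "\<forall>i\<in>{1..n}. g i \<in> S i"
      have "g i \<in> carrier G" if "i \<in> {1..n}" for i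
        using that g S[of i] normal_subset_carrier[of "S i"] by auto
      then have closed: "iter_commutator G g n \<in> carrier G"
        using n by (intro iter_commutator_conj(1)[OF _ one_closed]) auto
      have "commutator G (iter_commutator G g n) k \<in> ?M" if k: "k \<in> S (Suc n)" for k
      proof -
        have "iter_commutator G (g(Suc n := k)) n = iter_commutator G g n"
          using n by (auto simp: iter_commutator_def intro!: arg_cong2[of _ _ _ _ "foldl _"])
        then have "commutator G (iter_commutator G g n) k
            = iter_commutator G (g(Suc n := k)) (Suc n)"
          using n by (simp add: iter_commutator_Suc)
        moreover have "\<forall>i\<in>{1..Suc n}. (g(Suc n := k)) i \<in> S i"
          using g k by auto
        ultimately show ?thesis
          unfolding iter_commutator_subgroup_def by (intro generate.incl) blast
      qed
      then show "iter_commutator G g n \<in> centralizer_mod G ?M (S (Suc n))"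
        using closed by (simp add: centralizer_mod_def)
    qed
  qed
  then show "commutator_subgroup G ?C (S (Suc n)) \<subseteq> ?M"
    using commutator_subgroup_subset_iff M normal_subset_carrier[OF C] by blast
qed

lemma iter_commutator_subgroup_eq_foldl:
  assumes "n \<ge> 1" "\<And>i. i \<in> {1..n} \<Longrightarrow> S i \<lhd> G"
  shows "iter_commutator_subgroup G S n =
    foldl (commutator_subgroup G) (S 1) (map S [2..<Suc n])"
  using assms
proof (induction n rule: nat_induct_at_least)
  case base
  then have "S 1 \<lhd> G"
    by simp
  then show ?case
    using iter_commutator_subgroup_1[of S] by (simp add: normal_imp_subgroup)
next
  case (Suc n)
  have "iter_commutator_subgroup G S (Suc n) =
      commutator_subgroup G (iter_commutator_subgroup G S n) (S (Suc n))"
    using Suc.hyps Suc.prems by (rule iter_commutator_subgroup_Suc)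
  then show ?case
    using Suc by simp
qed

text \<open>This carries a normal subgroup \<open>H\<close> from the last place of a commutator to the first. The
  normal subgroups \<open>H\<close> and \<open>N\<close> vary in the induction: of the two terms given by the three
  subgroups lemma, one has \<open>[H, R i]\<close> for \<open>H\<close>, the other the centralizer of \<open>R i\<close> for \<open>N\<close>.\<close>

lemma foldl_commutator_subgroup_swap:
  fixes R :: "'i \<Rightarrow> 'a set"
  assumes "H \<lhd> G" "N \<lhd> G" "R k \<lhd> G" "\<And>i. i \<in> set is \<Longrightarrow> R i \<lhd> G"
    and "\<And>js. mset js = mset (k # is) \<Longrightarrow> foldl (commutator_subgroup G) H (map R js) \<subseteq> N"
  shows "commutator_subgroup G (foldl (commutator_subgroup G) (R k) (map R is)) H \<subseteq> N"
  using assms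
proof (induction "is" arbitrary: H N rule: rev_induct)
  case Nil
  then show ?case
    using Nil.prems(5)[of "[k]"] commutator_subgroup_commute normal_subset_carrier by simp
next
  case (snoc i "is")
  let ?C = "foldl (commutator_subgroup G) (R k) (map R is)"
  have Ri: "R i \<lhd> G" and C: "?C \<lhd> G"
    using snoc.prems by (auto intro!: foldl_commutator_subgroup_normal)
  have HR: "commutator_subgroup G H (R i) \<lhd> G"
    using snoc.prems(1) Ri by (rule commutator_subgroup_normal)
  have HC: "commutator_subgroup G H ?C \<lhd> G"
    using snoc.prems(1) C by (rule commutator_subgroup_normal)
  have "commutator_subgroup G ?C H \<subseteq> centralizer_mod G N (R i)"
  proof (rule snoc.IH)
    show "centralizer_mod G N (R i) \<lhd> G"
      using snoc.prems(2) Ri by (rule centralizer_mod_normal)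
    fix js assume js: "mset js = mset (k # is)"
    then have "set js = set (k # is)"
      by (rule mset_eq_setD)
    then have "foldl (commutator_subgroup G) H (map R js) \<lhd> G"
      using snoc.prems by (intro foldl_commutator_subgroup_normal) auto
    moreover have "foldl (commutator_subgroup G) H (map R (js @ [i])) \<subseteq> N"
      using js by (intro snoc.prems(5)) simp
    ultimately show "foldl (commutator_subgroup G) H (map R js) \<subseteq> centralizer_mod G N (R i)"
      using snoc.prems(2) by (simp add: commutator_subgroup_subset_iff normal_subset_carrier)
  qed (use snoc.prems in auto)
  then have 1: "commutator_subgroup G (commutator_subgroup G H ?C) (R i) \<subseteq> N"
    using snoc.prems(1,2) C HC
    by (simp add: commutator_subgroup_subset_iff normal_subset_carrier
        commutator_subgroup_commute[of H ?C])
  have "commutator_subgroup G ?C (commutator_subgroup G H (R i)) \<subseteq> N"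
  proof (rule snoc.IH)
    fix js assume "mset js = mset (k # is)"
    then have "foldl (commutator_subgroup G) H (map R (i # js)) \<subseteq> N"
      by (intro snoc.prems(5)) simp
    then show "foldl (commutator_subgroup G) (commutator_subgroup G H (R i)) (map R js) \<subseteq> N"
      by simp
  qed (use snoc.prems HR in auto)
  then have 2: "commutator_subgroup G (commutator_subgroup G H (R i)) ?C \<subseteq> N"
    using C HR by (simp add: commutator_subgroup_commute normal_subset_carrier)
  show ?case
    using three_subgroups[OF snoc.prems(1) C Ri snoc.prems(2) 1 2] by simp
qed


section \<open>Products of normal subgroups\<close>

text \<open>A product of normal subgroups is their least upper bound among the normal subgroups. This
  reduces an equation between two products to inclusions of single factors.\<close>

lemma finprod_normal_monoid_normal:
  assumes "\<And>i. i \<in> A \<Longrightarrow> f i \<lhd> G"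
  shows "finprod (normal_monoid G) f A \<lhd> G"
proof -
  interpret M: comm_monoid "normal_monoid G"
    by (rule normal_monoid_comm_monoid)
  have "finprod (normal_monoid G) f A \<in> carrier (normal_monoid G)"
    using assms by (intro M.finprod_closed) (auto simp: normal_monoid_def)
  then show ?thesis
    by (simp add: normal_monoid_def)
qed

lemma finprod_normal_monoid_upper:
  assumes "finite A" "\<And>i. i \<in> A \<Longrightarrow> f i \<lhd> G" "i \<in> A"
  shows "f i \<subseteq> finprod (normal_monoid G) f A"
proof -
  interpret M: comm_monoid "normal_monoid G"
    by (rule normal_monoid_comm_monoid)
  let ?P = "finprod (normal_monoid G) f (A - {i})"
  have P: "subgroup ?P G"
    using assms by (intro normal_imp_subgroup finprod_normal_monoid_normal) auto
  have "finprod (normal_monoid G) f (insert i (A - {i})) = f i \<otimes>\<^bsub>normal_monoid G\<^esub> ?P"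
    using assms by (intro M.finprod_insert) (auto simp: normal_monoid_def)
  then have eq: "finprod (normal_monoid G) f A = f i <#> ?P"
    using assms(3) by (simp add: insert_absorb normal_monoid_def)
  show ?thesis
  proof
    fix x assume x: "x \<in> f i"
    then have "x \<in> carrier G"
      using assms normal_subset_carrier by blast
    then have "x = x \<otimes> \<one>"
      by simp
    then show "x \<in> finprod (normal_monoid G) f A"
      unfolding eq set_mult_def using x subgroup.one_closed[OF P] by blast
  qed
qed

lemma finprod_normal_monoid_least:
  assumes "finite A" "N \<lhd> G" "\<And>i. i \<in> A \<Longrightarrow> f i \<lhd> G" "\<And>i. i \<in> A \<Longrightarrow> f i \<subseteq> N"
  shows "finprod (normal_monoid G) f A \<subseteq> N"
proof -
  interpret M: comm_monoid "normal_monoid G"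
    by (rule normal_monoid_comm_monoid)
  note N = normal_imp_subgroup[OF assms(2)]
  show ?thesis
    using assms(1,3,4)
  proof (induction A)
    case empty
    then show ?case
      unfolding M.finprod_empty using subgroup.one_closed[OF N]
      by (simp add: normal_monoid_def)
  next
    case (insert i A)
    have "finprod (normal_monoid G) f (insert i A) =
        f i \<otimes>\<^bsub>normal_monoid G\<^esub> finprod (normal_monoid G) f A"
      using insert by (intro M.finprod_insert) (auto simp: normal_monoid_def)
    also have "\<dots> = f i <#> finprod (normal_monoid G) f A"
      by (simp add: normal_monoid_def)
    also have "\<dots> \<subseteq> N"
    proof -
      have "f i \<subseteq> N" "finprod (normal_monoid G) f A \<subseteq> N"
        using insert by auto
      then show ?thesis
        unfolding set_mult_def using subgroup.m_closed[OF N] by blast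
    qed
    finally show ?case .
  qed
qed

end


section \<open>Moving the first subgroup to the front\<close>

lemma permutes_of_mset_eq_upt:
  assumes "mset xs = mset [m..<Suc n]"
  obtains \<tau> where "\<tau> permutes {m..n}" "map \<tau> [m..<Suc n] = xs"
proof
  define \<tau> where "\<tau> = (\<lambda>i. if i \<in> {m..n} then xs ! (i - m) else i)"
  have len: "length xs = Suc n - m"
    using mset_eq_length[OF assms] by (simp del: upt_Suc)
  show map: "map \<tau> [m..<Suc n] = xs"
    by (rule nth_equalityI) (auto simp: len \<tau>_def nth_upt simp del: upt_Suc)
  have set: "set [m..<Suc n] = {m..n}"
    by (auto simp del: upt_Suc)
  have "distinct xs" "set xs = {m..n}"
    using mset_eq_imp_distinct_iff[OF assms] mset_eq_setD[OF assms] set by (auto simp del: upt_Suc)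
  then have "distinct (map \<tau> [m..<Suc n])" "\<tau> ` {m..n} = {m..n}"
    unfolding map using arg_cong[OF map, of set] by (simp_all only: set_map set)
  then have "bij_betw \<tau> {m..n} {m..n}"
    unfolding bij_betw_def using set by (simp add: distinct_map del: upt_Suc)
  then show "\<tau> permutes {m..n}"
    by (rule bij_imp_permutes) (auto simp: \<tau>_def)
qed

lemma mset_map_permutes_upt:
  assumes "\<sigma> permutes {m..n}"
  shows "mset (map \<sigma> [m..<Suc n]) = mset [m..<Suc n]"
proof -
  have "mset [m..<Suc n] = mset_set {m..n}"
    by (metis atLeastLessThanSuc_atLeastAtMost mset_upt)
  then show ?thesis
    using assms
    by (metis finite_atLeastAtMost image_mset_mset_set mset_map permutes_image permutes_inj_on)
qed

context group
begin

text \<open>The factors \<open>B\<^sub>1, \<dots>, B\<^sub>m\<close> after \<open>R 1\<close> are moved to the right-hand side by the adjunction, so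
  that the swap lemma applies to what precedes them. It rearranges only the entries before \<open>R 1\<close>;
  after the adjunction is undone, each rearranged list is followed by the same \<open>B\<^sub>1, \<dots>, B\<^sub>m\<close>.\<close>

lemma iter_commutator_subgroup_permuted_subset:
  assumes n: "n \<ge> 1" and R: "\<And>i. i \<in> {1..n} \<Longrightarrow> R i \<lhd> G" and N: "N \<lhd> G"
    and first: "\<And>\<tau>. \<tau> permutes {2..n} \<Longrightarrow> iter_commutator_subgroup G (R \<circ> \<tau>) n \<subseteq> N"
    and \<sigma>: "\<sigma> permutes {1..n}"
  shows "iter_commutator_subgroup G (R \<circ> \<sigma>) n \<subseteq> N"
proof -
  have eq_foldl: "iter_commutator_subgroup G (R \<circ> \<rho>) n =
      foldl (commutator_subgroup G) (R (\<rho> 1)) (map R (map \<rho> [2..<Suc n]))"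
    if "\<rho> permutes {1..n}" for \<rho>
  proof -
    have "(R \<circ> \<rho>) i \<lhd> G" if "i \<in> {1..n}" for i
      using R[of "\<rho> i"] that permutes_in_image[OF \<open>\<rho> permutes {1..n}\<close>] by simp
    then show ?thesis
      using iter_commutator_subgroup_eq_foldl[OF n, of "R \<circ> \<rho>"] by (simp del: upt_Suc)
  qed
  have upt: "[1..<Suc n] = 1 # [2..<Suc n]"
    using n upt_conv_Cons[of 1 "Suc n"] by (simp add: numeral_2_eq_2 del: upt_Suc)
  have first_list: "foldl (commutator_subgroup G) (R 1) (map R js) \<subseteq> N"
    if js: "mset js = mset [2..<Suc n]" for js
  proof -
    obtain \<tau> where \<tau>: "\<tau> permutes {2..n}" "map \<tau> [2..<Suc n] = js"
      using permutes_of_mset_eq_upt[OF js] .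
    have "\<tau> 1 = 1"
      using \<tau>(1) by (rule permutes_not_in) simp
    moreover have "\<tau> permutes {1..n}"
      using \<tau>(1) by (rule permutes_subset) auto
    ultimately show ?thesis
      using first[OF \<tau>(1)] eq_foldl[of \<tau>] unfolding \<tau>(2) by simp
  qed
  let ?is = "map \<sigma> [2..<Suc n]"
  have perm: "mset (\<sigma> 1 # ?is) = mset (1 # [2..<Suc n])"
    using mset_map_permutes_upt[OF \<sigma>] unfolding upt by (simp del: upt_Suc)
  have set: "set (\<sigma> 1 # ?is) = {1..n}"
    using mset_eq_setD[OF perm] upt[symmetric] by (auto simp del: upt_Suc)
  have "foldl (commutator_subgroup G) (R (\<sigma> 1)) (map R ?is) \<subseteq> N"
  proof (cases "\<sigma> 1 = 1")
    case True
    then show ?thesis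
      using perm first_list[of ?is] by (simp del: upt_Suc)
  next
    case False
    moreover have "1 \<in> set (\<sigma> 1 # ?is)"
      unfolding set using n by simp
    ultimately have "1 \<in> set ?is"
      by (simp del: upt_Suc)
    then obtain as bs where split: "?is = as @ 1 # bs"
      by (meson split_list)
    let ?C = "foldl (commutator_subgroup G) (R (\<sigma> 1)) (map R as)"
    let ?N' = "foldr (\<lambda>K N. centralizer_mod G N K) (map R bs) N"
    have normal: "R i \<lhd> G" if "i \<in> set (\<sigma> 1 # as @ 1 # bs)" for i
      using R that set unfolding split by blast
    have N': "?N' \<lhd> G"
      using N normal by (intro foldr_centralizer_mod_normal) auto
    have C: "?C \<lhd> G"
      using normal by (intro foldl_commutator_subgroup_normal) auto
    have "commutator_subgroup G ?C (R 1) \<subseteq> ?N'"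
    proof (rule foldl_commutator_subgroup_swap)
      fix js assume js: "mset js = mset (\<sigma> 1 # as)"
      then have "set js = set (\<sigma> 1 # as)"
        by (rule mset_eq_setD)
      then have "foldl (commutator_subgroup G) (R 1) (map R js) \<lhd> G"
        using normal by (intro foldl_commutator_subgroup_normal) auto
      moreover have "mset (js @ bs) = mset [2..<Suc n]"
        using perm js unfolding split by (simp del: upt_Suc)
      ultimately show "foldl (commutator_subgroup G) (R 1) (map R js) \<subseteq> ?N'"
        using first_list[of "js @ bs"] N normal
        by (subst foldl_commutator_subgroup_subset_iff[symmetric]) auto
    qed (use N' normal in auto)
    moreover have "commutator_subgroup G ?C (R 1) \<lhd> G"
      using C normal by (intro commutator_subgroup_normal) auto
    ultimately have
      "foldl (commutator_subgroup G) (commutator_subgroup G ?C (R 1)) (map R bs) \<subseteq> N"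
      using N normal by (subst foldl_commutator_subgroup_subset_iff) auto
    then show ?thesis
      unfolding split by simp
  qed
  then show ?thesis
    using eq_foldl[OF \<sigma>] by simp
qed

end

theorem theorem1p2:
  fixes G (structure) and n :: nat and R :: "nat \<Rightarrow> 'a set"
  assumes "group G"
    and "n \<ge> 1"
    and "\<And>i. i \<in> {1..n} \<Longrightarrow> R i \<lhd> G"
  shows "symmetric_commutator_subgroup G R n =
    finprod (normal_monoid G) (\<lambda>\<sigma>. iter_commutator_subgroup G (R \<circ> \<sigma>) n)
      {\<sigma>. \<sigma> permutes {2..n}}"
proof -
  interpret group G
    by fact
  let ?f = "\<lambda>\<sigma>. iter_commutator_subgroup G (R \<circ> \<sigma>) n"
  let ?P = "finprod (normal_monoid G) ?f {\<sigma>. \<sigma> permutes {2..n}}"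
  let ?Q = "finprod (normal_monoid G) ?f {\<sigma>. \<sigma> permutes {1..n}}"
  have f_normal: "?f \<sigma> \<lhd> G" if "\<sigma> permutes {1..n}" for \<sigma>
    using iter_commutator_subgroup_permuted_in_carrier[OF assms(2,3) that]
    by (simp add: normal_monoid_def)
  have extend: "\<sigma> permutes {1..n}" if "\<sigma> permutes {2..n}" for \<sigma>
    using that by (rule permutes_subset) auto
  have fin: "finite {\<sigma>. \<sigma> permutes {m..n}}" for m
    by (simp add: finite_permutations)
  have P: "?P \<lhd> G" and Q: "?Q \<lhd> G"
    using f_normal extend by (auto intro!: finprod_normal_monoid_normal)
  have f_P: "?f \<tau> \<subseteq> ?P" if "\<tau> permutes {2..n}" for \<tau>
    using finprod_normal_monoid_upper[OF fin, of 2 ?f \<tau>] f_normal extend that by simp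
  have f_Q: "?f \<sigma> \<subseteq> ?Q" if "\<sigma> permutes {1..n}" for \<sigma>
    using finprod_normal_monoid_upper[OF fin, of 1 ?f \<sigma>] f_normal that by simp
  have "?Q \<subseteq> ?P"
  proof (rule finprod_normal_monoid_least[OF fin P])
    fix \<sigma> assume "\<sigma> \<in> {\<sigma>. \<sigma> permutes {1..n}}"
    then show "?f \<sigma> \<subseteq> ?P"
      using iter_commutator_subgroup_permuted_subset[OF assms(2,3) P f_P] by simp
  qed (use f_normal in simp)
  moreover have "?P \<subseteq> ?Q"
    using f_normal f_Q extend by (intro finprod_normal_monoid_least[OF fin Q]) auto
  ultimately show ?thesis
    unfolding symmetric_commutator_subgroup_def by simp
qed

end
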